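(* Let $r\ge 1$, $m_0\ge m_1\ge\cdots\ge m_r\ge 1$, $A_0=\sigma\sigma^*$ a real symmetric positive semidefinite $m_0\times m_0$ matrix, and $B_k$ a real $m_{k-1}\times m_k$ matrix of rank $m_k$ for $k=1,\dots,r$. Let $(P_t)_{t\ge0}$ be the semigroup on $\mathbb{R}^{m_0}\times\cdots\times\mathbb{R}^{m_r}$ of the diffusion $dX_1(t)=\sigma\,dB(t)$, $dX_{k+1}(t)=B_k^*X_k(t)\,dt$ $(1\le k\le r)$. Let $f\in C^2(\mathbb{R}^{m_0}\times\cdots\times\mathbb{R}^{m_r})$ be a positive, globally Lipschitz and bounded function. Then for every $t\ge 0$, every $x=(x^{(1)},\dots,x^{(r+1)})\in\mathbb{R}^{m_0}\times\cdots\times\mathbb{R}^{m_r}$ and all constants $\alpha_k\in\mathbb{R}$ $(2\le k\le r+1)$, with $\alpha_1=1$, $$P_tf(x)\left\|\sum_{i'=1}^{r+1}\alpha_{i'}\prod_{j=1}^{i'-1}B_j\,\nabla^{(i')}\ln P_tf(x)\right\|_{A_0}^2\le P_t\left(f\left\|\sum_{i'=1}^{r+1}\left(\sum_{i=0}^{i'-1}\alpha_{i'-i}\frac{t^i}{i!}\prod_{j=1}^{i'-1}B_j\right)\nabla^{(i')}\ln f\right\|_{A_0}^2\right)(x).$$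
   Context: $M^*$ denotes the transpose of a matrix $M$. $\sigma$ is a constant $m_0\times m_0$ matrix with $\sigma\sigma^*=A_0$, $B(t)$ is a standard Brownian motion in $\mathbb{R}^{m_0}$, and $X_{i}(t)$ is $\mathbb{R}^{m_{i-1}}$-valued for $1\le i\le r+1$. For $\mathbf{X}_t=(X_1(t),\dots,X_{r+1}(t))$, $P_tf(x)=\mathbb{E}^x[f(\mathbf{X}_t)]$, where $\mathbf{X}_0=x$. Points are written $x=(x^{(1)},\dots,x^{(r+1)})$ with $x^{(i)}\in\mathbb{R}^{m_{i-1}}$, and $\nabla^{(i)}f$ is the (column) vector of partial derivatives of $f$ with respect to the coordinates of $x^{(i)}$. Ordered products: $\prod_{j=1}^{k}B_j=B_1B_2\cdots B_k$, with the empty product ($k=0$) being the identity. For $v\in\mathbb{R}^{m_0}$, $\|v\|_{A_0}=\sqrt{v^*A_0v}$. *)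

theory Defs
  imports "HOL-Probability.Probability" "Jordan_Normal_Form.DL_Rank"
begin

(* Matrices and block vectors are those of Jordan_Normal_Form, whose dimensions are natural
   numbers, since the block sizes m 0, ..., m r vary with the block.  The state space
   R^(m 0) x ... x R^(m r) is a Euclidean space 'a whose standard orthonormal basis is labelled
   by block and position: e k j is the j-th (from 0) coordinate direction of block k, where
   block k has size m (k - 1) for k = 1, ..., r + 1. *)

definition block_basis :: "nat \<Rightarrow> (nat \<Rightarrow> nat) \<Rightarrow> (nat \<Rightarrow> nat \<Rightarrow> 'a::euclidean_space) \<Rightarrow> bool" where
  "block_basis r m e \<longleftrightarrow>
     bij_betw (\<lambda>(k, j). e k j) (SIGMA k:{1..r+1}. {..<m (k - 1)}) Basis"

definition block ::
  "(nat \<Rightarrow> nat) \<Rightarrow> (nat \<Rightarrow> nat \<Rightarrow> 'a::euclidean_space) \<Rightarrow> nat \<Rightarrow> 'a \<Rightarrow> real Matrix.vec" where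
  "block m e k x = Matrix.vec (m (k - 1)) (\<lambda>j. inner x (e k j))"

definition block_grad ::
  "(nat \<Rightarrow> nat) \<Rightarrow> (nat \<Rightarrow> nat \<Rightarrow> 'a::euclidean_space) \<Rightarrow> nat \<Rightarrow> ('a \<Rightarrow> real) \<Rightarrow> 'a
     \<Rightarrow> real Matrix.vec" where
  "block_grad m e k g x =
     Matrix.vec (m (k - 1)) (\<lambda>j. deriv (\<lambda>s. g (x + s *\<^sub>R e k j)) 0)"

definition C2 :: "('a::real_normed_vector \<Rightarrow> real) \<Rightarrow> bool" where
  "C2 f \<longleftrightarrow>
     (\<exists>(f' :: 'a \<Rightarrow> 'a \<Rightarrow>\<^sub>L real) (f'' :: 'a \<Rightarrow> 'a \<Rightarrow>\<^sub>L ('a \<Rightarrow>\<^sub>L real)).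
        (\<forall>x. (f has_derivative blinfun_apply (f' x)) (at x)) \<and>
        (\<forall>x. (f' has_derivative blinfun_apply (f'' x)) (at x)) \<and>
        continuous_on UNIV f'')"

fun ordered_prod :: "nat \<Rightarrow> (nat \<Rightarrow> real mat) \<Rightarrow> nat \<Rightarrow> real mat" where
  "ordered_prod d B 0 = 1\<^sub>m d"
| "ordered_prod d B (Suc k) = ordered_prod d B k * B (Suc k)"

definition seminorm_of :: "real mat \<Rightarrow> real Matrix.vec \<Rightarrow> real" where
  "seminorm_of A v = sqrt (scalar_prod v (A *\<^sub>v v))"

(* W j t is the j-th component at time t \<ge> 0.  All component increments over consecutive
   time intervals are jointly independent, i.e. the components are independent too. *)
definition standard_BM :: "'w measure \<Rightarrow> nat \<Rightarrow> (nat \<Rightarrow> real \<Rightarrow> 'w \<Rightarrow> real) \<Rightarrow> bool" where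
  "standard_BM M d W \<longleftrightarrow>
     prob_space M \<and>
     (\<forall>j<d. \<forall>t\<ge>0. W j t \<in> borel_measurable M) \<and>
     (AE \<omega> in M. \<forall>j<d. W j 0 \<omega> = 0) \<and>
     (AE \<omega> in M. \<forall>j<d. continuous_on {0..} (\<lambda>t. W j t \<omega>)) \<and>
     (\<forall>j<d. \<forall>s t. 0 \<le> s \<and> s < t \<longrightarrow>
        distributed M lborel (\<lambda>\<omega>. W j t \<omega> - W j s \<omega>) (normal_density 0 (sqrt (t - s)))) \<and>
     (\<forall>n (\<tau> :: nat \<Rightarrow> real). 0 \<le> \<tau> 0 \<and> (\<forall>i<n. \<tau> i < \<tau> (Suc i)) \<longrightarrow>
        prob_space.indep_vars M (\<lambda>_. borel)
          (\<lambda>(i, j) \<omega>. W j (\<tau> (Suc i)) \<omega> - W j (\<tau> i) \<omega>) ({..<n} \<times> {..<d}))"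

(* X solves dX_1 = \<sigma> dW, dX_(k+1) = (B k)^* X_k dt (1 \<le> k \<le> r), X 0 = x, in integrated form;
   as \<sigma> is constant, the stochastic integral of \<sigma> is \<sigma> W(t).  The initial condition is the
   case t = 0, where W(0) = 0. *)
definition solves_SDE ::
  "'w measure \<Rightarrow> nat \<Rightarrow> (nat \<Rightarrow> nat) \<Rightarrow> (nat \<Rightarrow> nat \<Rightarrow> 'a::euclidean_space) \<Rightarrow> real mat
     \<Rightarrow> (nat \<Rightarrow> real mat) \<Rightarrow> (nat \<Rightarrow> real \<Rightarrow> 'w \<Rightarrow> real) \<Rightarrow> 'a \<Rightarrow> (real \<Rightarrow> 'w \<Rightarrow> 'a) \<Rightarrow> bool" where
  "solves_SDE M r m e \<sigma> B W x X \<longleftrightarrow>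
     (\<forall>t\<ge>0. X t \<in> borel_measurable M) \<and>
     (AE \<omega> in M. \<forall>t\<ge>0.
        block m e 1 (X t \<omega>) = block m e 1 x + \<sigma> *\<^sub>v Matrix.vec (m 0) (\<lambda>j. W j t \<omega>) \<and>
        (\<forall>k\<in>{1..r}. \<forall>j<m k.
           ((\<lambda>s. vec_index (transpose_mat (B k) *\<^sub>v block m e k (X s \<omega>)) j) has_integral
             (vec_index (block m e (k + 1) (X t \<omega>)) j - vec_index (block m e (k + 1) x) j))
           {0..t}))"

(* X x is the process started at x. *)
definition diffusion_semigroup ::
  "'w measure \<Rightarrow> ('a \<Rightarrow> real \<Rightarrow> 'w \<Rightarrow> 'a) \<Rightarrow> real \<Rightarrow> ('a \<Rightarrow> real) \<Rightarrow> 'a \<Rightarrow> real" where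
  "diffusion_semigroup M X t f x = (\<integral>\<omega>. f (X x t \<omega>) \<partial>M)"

(* The same semigroup on nonnegative functions, with values in [0, \<infinity>]; it is needed for
   functions that are not known to be integrable. *)
definition nn_diffusion_semigroup ::
  "'w measure \<Rightarrow> ('a \<Rightarrow> real \<Rightarrow> 'w \<Rightarrow> 'a) \<Rightarrow> real \<Rightarrow> ('a \<Rightarrow> real) \<Rightarrow> 'a \<Rightarrow> ennreal" where
  "nn_diffusion_semigroup M X t f x = (\<integral>\<^sup>+\<omega>. ennreal (f (X x t \<omega>)) \<partial>M)"

end

theory Submission
  imports Defs
begin

text \<open>The equation is linear with additive noise, so two solutions driven by the same Brownian
  motion differ by a deterministic vector: $X^{x+h}_t = X^x_t + \Phi_t h$, where
  $\Phi_t = \exp(tN)$ is the flow of the linear field $N$ that sends the $k$-th block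
  $h^{(k)}$ to $B_k^* h^{(k)}$ in block $k+1$ and puts $0$ in the first block. As $N$ is nilpotent,
  the exponential is a polynomial in $t$ (\<open>integral_equation_nilpotent\<close>,
  \<open>solutions_differ_by_flow\<close>). Differentiating under the expectation gives
  $\partial_h P_t f(x) = E[f'(X^x_t)(\Phi_t h)]$ (\<open>expectation_directional_derivative\<close>).

  Take a vector $u$ in the first block and write $C_k = B_1 \cdots B_{k-1}$. The scalar product
  of $u$ with the weighted gradient $\sum_k \alpha_k C_k \nabla^{(k)} g$ is the derivative of $g$
  along $v = \sum_k \alpha_k C_k^* u$, with $C_k^* u$ sitting in block $k$
  (\<open>scalar_prod_weighted_gradient\<close>). The field $N$ moves $C_k^* u$ in block $k$ to
  $C_{k+1}^* u$ in block $k+1$, so $\Phi_t v$ has blocks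
  $(\sum_{i<k} \alpha_{k-i} t^i / i!)\, C_k^* u$ (\<open>flow_lift_combination\<close>): these are exactly
  the coefficients on the right of the inequality. Hence, if $G$ and $H$ denote the two combined
  gradients of the logarithms, $P_t f \cdot (u^* G) = P_t (f \cdot u^* H)$.

  With $A_0 = \sigma\sigma^*$ the squared seminorm of $G$ is the sum of $(u^* G)^2$ over the
  columns $u$ of $\sigma$ (\<open>seminorm_of_gram_sq\<close>), and the estimate is the Cauchy-Schwarz
  inequality for the weight $f(X^x_t)$, summed over the columns
  (\<open>weighted_Cauchy_Schwarz\<close>).\<close>

section \<open>Flows of nilpotent linear fields\<close>

lemma linear_funpow:
  fixes N :: "'a::real_vector \<Rightarrow> 'a"
  assumes "linear N"
  shows "linear (N ^^ i)"
proof (induction i)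
  case 0
  then show ?case by (simp add: linear_id[unfolded id_def] id_def)
next
  case (Suc i)
  then show ?case using linear_compose[OF Suc assms] by (simp add: o_def)
qed

text \<open>This is $\exp(tN)h$ whenever $N^{r+1} = 0$.\<close>

definition nilpotent_flow :: "nat \<Rightarrow> ('a::real_vector \<Rightarrow> 'a) \<Rightarrow> real \<Rightarrow> 'a \<Rightarrow> 'a" where
  "nilpotent_flow r N t h = (\<Sum>i\<le>r. (t ^ i / fact i) *\<^sub>R (N ^^ i) h)"

lemma linear_nilpotent_flow:
  assumes "linear N"
  shows "linear (nilpotent_flow r N t)"
proof -
  have "linear (\<lambda>h. (t ^ i / fact i) *\<^sub>R (N ^^ i) h)" for i
    by (intro linear_compose_scale_right linear_funpow assms)
  then show ?thesis
    unfolding nilpotent_flow_def[abs_def] by (intro linear_compose_sum) auto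
qed

lemma has_integral_taylor_monomial:
  fixes t :: real
  assumes "t \<ge> 0"
  shows "((\<lambda>s. s ^ i / fact i) has_integral t ^ Suc i / fact (Suc i)) {0..t}"
proof -
  have "((\<lambda>s. s ^ i / fact i) has_integral
          t ^ Suc i / fact (Suc i) - 0 ^ Suc i / fact (Suc i)) {0..t}"
  proof (rule fundamental_theorem_of_calculus[OF assms])
    fix s :: real
    have "((\<lambda>s. s ^ Suc i / fact (Suc i)) has_real_derivative
        (real (Suc i) * s ^ i) / fact (Suc i)) (at s within {0..t})"
      using DERIV_cdivide[OF DERIV_pow[of "Suc i" s "{0..t}"], of "fact (Suc i)"] by simp
    also have "(real (Suc i) * s ^ i) / fact (Suc i) = s ^ i / fact i"
      by (simp add: field_simps del: of_nat_Suc)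
    finally show "((\<lambda>s. s ^ Suc i / fact (Suc i)) has_vector_derivative s ^ i / fact i)
        (at s within {0..t})"
      by (simp add: has_real_derivative_iff_has_vector_derivative)
  qed
  then show ?thesis by simp
qed

text \<open>Downward induction on the power of $N$: once $N^{p+1} D$ is known to be a polynomial in time,
  applying $N^p$ to the integral equation and integrating that polynomial determines $N^p D$. The
  start $N^{r+1} D = 0$ is nilpotency.\<close>

lemma integral_equation_nilpotent:
  fixes N :: "'a::euclidean_space \<Rightarrow> 'a"
  assumes lin: "linear N" and nil: "\<And>v. (N ^^ Suc r) v = 0"
    and eq: "\<And>t. t \<ge> 0 \<Longrightarrow> ((\<lambda>s. N (D s)) has_integral D t - h) {0..t}"
    and "t \<ge> 0"
  shows "D t = nilpotent_flow r N t h"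
proof -
  have "\<forall>t\<ge>0. (N ^^ (Suc r - n)) (D t)
           = (\<Sum>i<n. (t ^ i / fact i) *\<^sub>R (N ^^ (Suc r - n + i)) h)" if "n \<le> Suc r" for n
    using that
  proof (induction n)
    case 0
    then show ?case using nil by simp
  next
    case (Suc n)
    \<comment> \<open>the index of the power reached at stage \<open>Suc n\<close>\<close>
    define p where "p = r - n"
    have p: "Suc r - n = Suc p" "Suc r - Suc n = p" using Suc.prems by (auto simp: p_def)
    have IH: "(N ^^ Suc p) (D s) = (\<Sum>i<n. (s ^ i / fact i) *\<^sub>R (N ^^ (Suc p + i)) h)"
      if "s \<ge> 0" for s using Suc.IH Suc.prems that unfolding p(1) by simp
    show ?case unfolding p
    proof (intro allI impI)
      fix t :: real assume t: "t \<ge> 0"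
      have "((\<lambda>s. (N ^^ p) (N (D s))) has_integral (N ^^ p) (D t - h)) {0..t}"
        using has_integral_linear[OF eq[OF t], of "N ^^ p"] linear_funpow[OF lin, of p]
        by (simp add: linear_conv_bounded_linear o_def)
      then have 1: "((\<lambda>s. (N ^^ Suc p) (D s)) has_integral (N ^^ p) (D t) - (N ^^ p) h) {0..t}"
        by (simp add: funpow_swap1 linear_diff[OF linear_funpow[OF lin]])
      have "((\<lambda>s. \<Sum>i<n. (s ^ i / fact i) *\<^sub>R (N ^^ (Suc p + i)) h) has_integral
              (\<Sum>i<n. (t ^ Suc i / fact (Suc i)) *\<^sub>R (N ^^ (Suc p + i)) h)) {0..t}"
        by (intro has_integral_sum has_integral_scaleR_left has_integral_taylor_monomial t) auto
      then have 2: "((\<lambda>s. (N ^^ Suc p) (D s)) has_integral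
              (\<Sum>i<n. (t ^ Suc i / fact (Suc i)) *\<^sub>R (N ^^ (Suc p + i)) h)) {0..t}"
        by (rule has_integral_eq[rotated]) (use IH in auto)
      have "(N ^^ p) (D t) - (N ^^ p) h
             = (\<Sum>i<n. (t ^ Suc i / fact (Suc i)) *\<^sub>R (N ^^ (Suc p + i)) h)"
        using has_integral_unique[OF 1 2] .
      then show "(N ^^ p) (D t) = (\<Sum>i<Suc n. (t ^ i / fact i) *\<^sub>R (N ^^ (p + i)) h)"
        by (subst sum.lessThan_Suc_shift) (simp add: algebra_simps)
    qed
  qed
  from this[of "Suc r"] \<open>t \<ge> 0\<close> show ?thesis
    by (simp add: nilpotent_flow_def lessThan_Suc_atMost)
qed

section \<open>Expectations of translated functions\<close>

lemma DERIV_along_line: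
  fixes f :: "'b::real_normed_vector \<Rightarrow> real"
  assumes f: "(f has_derivative f') (at y)"
  shows "((\<lambda>s. f (y + s *\<^sub>R h)) has_real_derivative f' h) (at 0)"
proof -
  have d: "(f has_derivative f') (at (y + 0 *\<^sub>R h))" using f by simp
  have "((\<lambda>s. f (y + s *\<^sub>R h)) has_derivative (\<lambda>s. f' (s *\<^sub>R h))) (at 0)"
    by (rule has_derivative_compose[of "\<lambda>s. y + s *\<^sub>R h" "\<lambda>s. s *\<^sub>R h" 0 UNIV f f', OF _ d])
       (auto intro!: derivative_eq_intros)
  moreover have "f' (s *\<^sub>R h) = f' h * s" for s
    using linear_cmul[OF has_derivative_linear[OF f]] by simp
  ultimately show ?thesis by (simp add: has_field_derivative_def)
qed

context prob_space
begin

text \<open>The difference quotients are dominated by $L \|w\|$ because $f$ is $L$-Lipschitz, so the limit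
  may be taken inside the expectation. Boundedness of $f$ makes the expectations themselves
  finite. The limit of the quotients is measurable and dominated as well, hence integrable.\<close>

lemma expectation_directional_derivative:
  fixes f :: "'b::euclidean_space \<Rightarrow> real" and f' :: "'b \<Rightarrow> 'b \<Rightarrow>\<^sub>L real"
  assumes Z: "Z \<in> borel_measurable M"
    and der: "\<And>y. (f has_derivative f' y) (at y)"
    and lip: "L-lipschitz_on UNIV f" and bdd: "bounded (range f)"
  shows "integrable M (\<lambda>\<omega>. f' (Z \<omega>) w)"
    and "((\<lambda>s. expectation (\<lambda>\<omega>. f (Z \<omega> + s *\<^sub>R w))) has_real_derivative
            expectation (\<lambda>\<omega>. f' (Z \<omega>) w)) (at 0)"
proof -
  have contf: "continuous_on UNIV f"
    using has_derivative_continuous[OF der] by (auto intro!: continuous_at_imp_continuous_on)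
  have fm: "f \<in> borel_measurable borel" by (rule borel_measurable_continuous_onI[OF contf])
  obtain K where K: "\<And>y. \<bar>f y\<bar> \<le> K" using bdd by (auto simp: bounded_iff)
  have meas: "(\<lambda>\<omega>. f (Z \<omega> + s *\<^sub>R w)) \<in> borel_measurable M" for s
    using Z fm by measurable
  have int: "integrable M (\<lambda>\<omega>. f (Z \<omega> + s *\<^sub>R w))" for s
    by (rule integrable_const_bound[where B = K]) (use K meas in auto)
  let ?q = "\<lambda>s \<omega>. (f (Z \<omega> + s *\<^sub>R w) - f (Z \<omega>)) / s"
  have pt: "((\<lambda>s. ?q s \<omega>) \<longlongrightarrow> f' (Z \<omega>) w) (at 0)" for \<omega>
    using DERIV_along_line[OF der, of "Z \<omega>" w] by (simp add: DERIV_def)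
  have qbound: "\<bar>?q s \<omega>\<bar> \<le> L * norm w" for s \<omega>
  proof (cases "s = 0")
    case True
    then show ?thesis using lipschitz_on_nonneg[OF lip] by simp
  next
    case False
    have "\<bar>f (Z \<omega> + s *\<^sub>R w) - f (Z \<omega>)\<bar> \<le> L * (\<bar>s\<bar> * norm w)"
      using lipschitz_onD[OF lip, of "Z \<omega> + s *\<^sub>R w" "Z \<omega>"] by (simp add: dist_norm)
    then show ?thesis using False by (simp add: divide_simps algebra_simps)
  qed
  have qm: "?q s \<in> borel_measurable M" for s
    using meas[of s] meas[of 0] by simp
  have seq: "(\<lambda>n. ?q (S n) \<omega>) \<longlonglongrightarrow> f' (Z \<omega>) w"
    if "S \<longlonglongrightarrow> 0" "\<And>n. S n \<noteq> 0" for S \<omega>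
    using pt[of \<omega>] that unfolding tendsto_at_iff_sequentially by (auto simp: o_def)
  have inv: "(\<lambda>n. inverse (real (Suc n))) \<longlonglongrightarrow> 0" by (rule LIMSEQ_inverse_real_of_nat)
  have derm: "(\<lambda>\<omega>. f' (Z \<omega>) w) \<in> borel_measurable M"
    by (rule borel_measurable_LIMSEQ_metric[OF qm[of "inverse (real (Suc _))"]])
       (rule seq[OF inv], simp)
  show "integrable M (\<lambda>\<omega>. f' (Z \<omega>) w)"
  proof (rule integrable_dominated_convergence
          [where w = "\<lambda>_. L * norm w" and s = "\<lambda>n. ?q (inverse (real (Suc n)))"])
    show "AE \<omega> in M. (\<lambda>n. ?q (inverse (real (Suc n))) \<omega>) \<longlonglongrightarrow> f' (Z \<omega>) w"
      by (intro AE_I2 seq[OF inv]) simp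
    show "AE \<omega> in M. norm (?q (inverse (real (Suc n))) \<omega>) \<le> L * norm w" for n
      unfolding real_norm_def by (intro AE_I2 qbound)
  qed (auto simp: derm qm)
  have lim: "((\<lambda>s. expectation (?q s)) \<longlongrightarrow> expectation (\<lambda>\<omega>. f' (Z \<omega>) w)) (at 0)"
    unfolding tendsto_at_iff_sequentially
  proof (intro allI impI)
    fix S :: "nat \<Rightarrow> real"
    assume S: "\<forall>i. S i \<in> UNIV - {0}" "S \<longlonglongrightarrow> 0"
    show "((\<lambda>s. expectation (?q s)) \<circ> S) \<longlonglongrightarrow> expectation (\<lambda>\<omega>. f' (Z \<omega>) w)"
      unfolding o_def
      by (rule integral_dominated_convergence[where w = "\<lambda>_. L * norm w"])
         (use derm qm seq[OF S(2)] S(1) qbound in auto)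
  qed
  have "expectation (?q s)
      = (expectation (\<lambda>\<omega>. f (Z \<omega> + s *\<^sub>R w)) - expectation (\<lambda>\<omega>. f (Z \<omega>))) / s" for s
    using int[of s] int[of 0] by simp
  with lim show "((\<lambda>s. expectation (\<lambda>\<omega>. f (Z \<omega> + s *\<^sub>R w))) has_real_derivative
            expectation (\<lambda>\<omega>. f' (Z \<omega>) w)) (at 0)"
    unfolding DERIV_def by (simp only: add_0 scale_zero_left add_0_right)
qed

lemma expectation_pos:
  assumes g: "integrable M g" and gpos: "\<And>\<omega>. g \<omega> > (0::real)"
  shows "expectation g > 0"
proof -
  have nn: "g \<omega> \<ge> 0" for \<omega> using gpos[of \<omega>] by simp
  have "expectation g \<noteq> 0"
  proof
    assume "expectation g = 0"
    then have "AE \<omega> in M. g \<omega> = 0"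
      using integral_nonneg_eq_0_iff_AE[OF g] nn by simp
    then have "AE \<omega> in M. False"
      by (rule AE_mp) (auto simp: less_imp_neq[OF gpos, symmetric])
    then show False by simp
  qed
  moreover have "expectation g \<ge> 0" using nn by (intro Bochner_Integration.integral_nonneg) auto
  ultimately show ?thesis by simp
qed

text \<open>The right-hand side may be infinite, as $1/g$ need not be bounded. The tangent line
  inequality $F^2/g \ge 2cF - c^2 g$ avoids a case distinction: its right-hand side is integrable,
  and the choice $c = E F / E g$ turns its expectation into $(E F)^2 / E g$.\<close>

lemma weighted_Cauchy_Schwarz:
  fixes F :: "'l \<Rightarrow> 'a \<Rightarrow> real"
  assumes g: "integrable M g" and gpos: "\<And>\<omega>. g \<omega> > 0" and F: "\<And>l. integrable M (F l)"
    and S: "finite S"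
  shows "ennreal (expectation g * (\<Sum>l\<in>S. (expectation (F l) / expectation g)\<^sup>2))
           \<le> (\<integral>\<^sup>+\<omega>. ennreal (g \<omega> * (\<Sum>l\<in>S. (F l \<omega> / g \<omega>)\<^sup>2)) \<partial>M)"
proof -
  let ?P = "expectation g"
  define c where "c l = expectation (F l) / ?P" for l
  define T where "T \<omega> = (\<Sum>l\<in>S. 2 * c l * F l \<omega> - (c l)\<^sup>2 * g \<omega>)" for \<omega>
  have P: "?P > 0" by (rule expectation_pos[OF g gpos])
  have Tint: "integrable M T" unfolding T_def using g F by auto
  have le: "T \<omega> \<le> g \<omega> * (\<Sum>l\<in>S. (F l \<omega> / g \<omega>)\<^sup>2)" for \<omega>
  proof -
    have "2 * c l * F l \<omega> - (c l)\<^sup>2 * g \<omega> \<le> g \<omega> * (F l \<omega> / g \<omega>)\<^sup>2" for l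
    proof -
      have "0 \<le> g \<omega> * (F l \<omega> / g \<omega> - c l)\<^sup>2" using gpos[of \<omega>] by simp
      also have "\<dots> = g \<omega> * (F l \<omega> / g \<omega>)\<^sup>2 - (2 * c l * F l \<omega> - (c l)\<^sup>2 * g \<omega>)"
        using gpos[of \<omega>] by (simp add: power2_eq_square field_simps)
      finally show ?thesis by simp
    qed
    then show ?thesis by (simp add: T_def sum_distrib_left sum_mono)
  qed
  have "expectation T = (\<Sum>l\<in>S. 2 * c l * expectation (F l) - (c l)\<^sup>2 * ?P)"
    unfolding T_def using g F by simp
  also have "\<dots> = (\<Sum>l\<in>S. ?P * (c l)\<^sup>2)"
    using P by (intro sum.cong) (auto simp: c_def power2_eq_square field_simps)
  finally have "ennreal (?P * (\<Sum>l\<in>S. (c l)\<^sup>2)) = ennreal (expectation T)"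
    by (simp add: sum_distrib_left)
  \<comment> \<open>\<open>T\<close> may be negative; the positive part is needed to pass to the integral in \<open>[0, \<infinity>]\<close>\<close>
  also have "\<dots> \<le> ennreal (expectation (\<lambda>\<omega>. max 0 (T \<omega>)))"
    using Tint by (intro ennreal_leI integral_mono) auto
  also have "\<dots> = (\<integral>\<^sup>+\<omega>. ennreal (max 0 (T \<omega>)) \<partial>M)"
    using Tint by (intro nn_integral_eq_integral[symmetric]) auto
  also have "\<dots> \<le> (\<integral>\<^sup>+\<omega>. ennreal (g \<omega> * (\<Sum>l\<in>S. (F l \<omega> / g \<omega>)\<^sup>2)) \<partial>M)"
  proof (intro nn_integral_mono ennreal_leI)
    fix \<omega>
    have "0 \<le> g \<omega> * (\<Sum>l\<in>S. (F l \<omega> / g \<omega>)\<^sup>2)"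
      using gpos[of \<omega>] by (intro mult_nonneg_nonneg sum_nonneg) auto
    with le[of \<omega>] show "max 0 (T \<omega>) \<le> g \<omega> * (\<Sum>l\<in>S. (F l \<omega> / g \<omega>)\<^sup>2)" by simp
  qed
  finally show ?thesis by (simp add: c_def)
qed

end

section \<open>Block coordinates\<close>

lemma scalar_prod_finsum_vec:
  fixes u :: "real Matrix.vec"
  assumes F: "finite F" and vs: "vs \<in> F \<rightarrow> carrier_vec n"
  shows "scalar_prod u (finsum_vec TYPE(real) n vs F) = (\<Sum>k\<in>F. scalar_prod u (vs k))"
proof -
  have c: "finsum_vec TYPE(real) n vs F \<in> carrier_vec n"
    by (rule finsum_vec_closed[OF vs])
  have d: "dim_vec (vs k) = n" if "k \<in> F" for k using funcset_mem[OF vs that] by simp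
  have "scalar_prod u (finsum_vec TYPE(real) n vs F)
      = (\<Sum>i\<in>{0..<n}. \<Sum>k\<in>F. vec_index u i * vec_index (vs k) i)"
    using c index_finsum_vec[OF F _ vs]
    by (simp add: scalar_prod_def sum_distrib_left)
  also have "\<dots> = (\<Sum>k\<in>F. scalar_prod u (vs k))"
    by (subst sum.swap) (simp add: scalar_prod_def d)
  finally show ?thesis .
qed

lemma smult_mat_mult_vec:
  fixes A :: "real mat"
  assumes "A \<in> carrier_mat n d" "w \<in> carrier_vec d"
  shows "(c \<cdot>\<^sub>m A) *\<^sub>v w = c \<cdot>\<^sub>v (A *\<^sub>v w)"
  using assms by (intro eq_vecI) (auto simp: scalar_prod_def sum_distrib_left mult.assoc)

text \<open>$v^* S S^* v = \|S^* v\|^2$. In this form the seminorm only involves scalar products with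
  fixed vectors, each of which is a directional derivative when $v$ is a combined gradient.\<close>

lemma seminorm_of_gram_sq:
  assumes S: "S \<in> carrier_mat n d" and v: "v \<in> carrier_vec n"
  shows "(seminorm_of (S * transpose_mat S) v)\<^sup>2 = (\<Sum>l<d. (scalar_prod (col S l) v)\<^sup>2)"
proof -
  let ?w = "transpose_mat S *\<^sub>v v"
  have w: "?w \<in> carrier_vec d" using S v by simp
  have "scalar_prod v ((S * transpose_mat S) *\<^sub>v v) = scalar_prod v (S *\<^sub>v ?w)"
    using assoc_mult_mat_vec[OF S _ v, of "transpose_mat S"] S by simp
  also have "\<dots> = scalar_prod ?w ?w"
    by (rule transpose_vec_mult_scalar[OF S w v, symmetric])
  also have "\<dots> = (\<Sum>l<d. (scalar_prod (col S l) v)\<^sup>2)"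
    using S v by (auto simp: scalar_prod_def[of ?w] power2_eq_square lessThan_atLeast0
        intro!: sum.cong)
  finally show ?thesis by (simp add: seminorm_of_def sum_nonneg)
qed

locale block_chain =
  fixes r :: nat and m :: "nat \<Rightarrow> nat" and e :: "nat \<Rightarrow> nat \<Rightarrow> 'a::euclidean_space"
    and B :: "nat \<Rightarrow> real mat"
  assumes basis: "block_basis r m e"
    and B_carrier: "\<And>k. k \<in> {1..r} \<Longrightarrow> B k \<in> carrier_mat (m (k - 1)) (m k)"
begin

definition positions :: "(nat \<times> nat) set" where
  "positions = (SIGMA k:{1..r+1}. {..<m (k - 1)})"

lemma finite_positions: "finite positions"
  by (simp add: positions_def)

lemma inner_e:
  assumes "(k, j) \<in> positions" "(k', j') \<in> positions"
  shows "inner (e k j) (e k' j') = (if (k', j') = (k, j) then 1 else 0)"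
proof -
  have bij: "bij_betw (\<lambda>(k, j). e k j) positions Basis"
    using basis by (simp add: block_basis_def positions_def)
  have "e k j \<in> Basis" "e k' j' \<in> Basis"
    using assms bij_betwE[OF bij] by force+
  moreover have "e k j = e k' j' \<longleftrightarrow> (k', j') = (k, j)"
    using inj_onD[OF bij_betw_imp_inj_on[OF bij], of "(k, j)" "(k', j')"] assms by auto
  ultimately show ?thesis by (simp add: inner_Basis)
qed

lemma Basis_eq: "Basis = (\<lambda>(k, j). e k j) ` positions"
  using basis by (simp add: block_basis_def positions_def bij_betw_def)

lemma eqI_coords:
  assumes "\<And>k j. (k, j) \<in> positions \<Longrightarrow> inner x (e k j) = inner y (e k j)"
  shows "x = y"
  by (rule euclidean_eqI) (use assms in \<open>auto simp: Basis_eq\<close>)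

definition of_coords :: "(nat \<Rightarrow> nat \<Rightarrow> real) \<Rightarrow> 'a" where
  "of_coords c = (\<Sum>(k, j)\<in>positions. c k j *\<^sub>R e k j)"

lemma inner_of_coords:
  assumes "(k, j) \<in> positions"
  shows "inner (of_coords c) (e k j) = c k j"
proof -
  have "inner (of_coords c) (e k j) = (\<Sum>p\<in>positions. if p = (k, j) then c k j else 0)"
    unfolding of_coords_def inner_sum_left
    by (intro sum.cong refl) (use assms in \<open>auto simp: inner_e split: if_splits\<close>)
  then show ?thesis using assms finite_positions by simp
qed

text \<open>The linear part $N$ of the equation, acting on all blocks at once.\<close>

definition drift :: "'a \<Rightarrow> 'a" where
  "drift h = of_coords (\<lambda>k j. if k = 1 then 0
     else vec_index (transpose_mat (B (k - 1)) *\<^sub>v block m e (k - 1) h) j)"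

lemma position_cases:
  assumes "(k, j) \<in> positions"
  obtains (noisy) "k = 1" "j < m 0" | (driven) l where "k = Suc l" "l \<in> {1..r}" "j < m l"
proof (cases "k = 1")
  case True
  then show ?thesis using assms by (intro noisy) (auto simp: positions_def)
next
  case False
  then show ?thesis using assms
    by (intro driven[of "k - 1"]) (auto simp: positions_def)
qed

lemma noisy_position: "j < m 0 \<Longrightarrow> (1, j) \<in> positions"
  and driven_position: "l \<in> {1..r} \<Longrightarrow> j < m l \<Longrightarrow> (Suc l, j) \<in> positions"
  by (auto simp: positions_def)

lemma transpose_mult_block_index:
  assumes "l \<in> {1..r}" "j < m l"
  shows "vec_index (transpose_mat (B l) *\<^sub>v block m e l z) j
           = (\<Sum>i<m (l - 1). B l $$ (i, j) * inner z (e l i))"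
  using assms B_carrier[OF assms(1)]
  by (auto simp: block_def scalar_prod_def lessThan_atLeast0 intro!: sum.cong)

lemma inner_drift_noisy: "j < m 0 \<Longrightarrow> inner (drift h) (e 1 j) = 0"
  by (simp add: drift_def inner_of_coords[OF noisy_position, simplified])

lemma inner_drift_driven:
  assumes "l \<in> {1..r}" "j < m l"
  shows "inner (drift h) (e (Suc l) j) = (\<Sum>i<m (l - 1). B l $$ (i, j) * inner h (e l i))"
  using assms transpose_mult_block_index[OF assms]
  by (simp add: drift_def inner_of_coords[OF driven_position[OF assms]])

lemma linear_drift: "linear drift"
proof (rule linearI)
  show "drift (x + y) = drift x + drift y" for x y
  proof (rule eqI_coords)
    fix k j assume "(k, j) \<in> positions"
    then show "inner (drift (x + y)) (e k j) = inner (drift x + drift y) (e k j)"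
      by (cases rule: position_cases)
         (simp_all add: inner_drift_noisy[simplified] inner_drift_driven inner_add_left
            sum.distrib algebra_simps)
  qed
  show "drift (c *\<^sub>R x) = c *\<^sub>R drift x" for c x
  proof (rule eqI_coords)
    fix k j assume "(k, j) \<in> positions"
    then show "inner (drift (c *\<^sub>R x)) (e k j) = inner (c *\<^sub>R drift x) (e k j)"
      by (cases rule: position_cases)
         (simp_all add: inner_drift_noisy[simplified] inner_drift_driven sum_distrib_left
            algebra_simps)
  qed
qed

text \<open>Each application of the drift shifts the content of every block one block further, so after
  $i$ steps the first $i$ blocks are empty.\<close>

lemma drift_pow_low_blocks:
  assumes "(k, j) \<in> positions" "k \<le> i"
  shows "inner ((drift ^^ i) h) (e k j) = 0"
  using assms
proof (induction i arbitrary: k j)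
  case 0
  then show ?case by (simp add: positions_def)
next
  case (Suc i)
  from Suc.prems(1) show ?case
  proof (cases rule: position_cases)
    case noisy
    then show ?thesis by (simp add: inner_drift_noisy[simplified])
  next
    case (driven l)
    have "inner ((drift ^^ i) h) (e l n) = 0" if "n < m (l - 1)" for n
      using Suc.IH[of l n] Suc.prems(2) driven that by (auto simp: positions_def)
    then show ?thesis using driven by (simp add: inner_drift_driven)
  qed
qed

lemma drift_nilpotent: "(drift ^^ Suc r) h = 0"
  by (rule eqI_coords, subst drift_pow_low_blocks) (auto simp: positions_def)

abbreviation flow :: "real \<Rightarrow> 'a \<Rightarrow> 'a" where
  "flow \<equiv> nilpotent_flow r drift"

text \<open>The noise $\sigma W_t$ cancels in the difference $D$ of the two solutions, which therefore
  satisfies $D(t) - (y - x) = \int_0^t N D(s)\,ds$ path by path. The null set depends on the two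
  starting points, which is harmless since only two of them are compared at a time.\<close>

lemma solutions_differ_by_flow:
  assumes X: "solves_SDE M r m e \<sigma> B W x X" and Y: "solves_SDE M r m e \<sigma> B W y Y"
  shows "AE \<omega> in M. \<forall>t\<ge>0. Y t \<omega> = X t \<omega> + flow t (y - x)"
proof -
  have "AE \<omega> in M. \<forall>t\<ge>0.
        block m e 1 (X t \<omega>) = block m e 1 x + \<sigma> *\<^sub>v Matrix.vec (m 0) (\<lambda>j. W j t \<omega>) \<and>
        (\<forall>k\<in>{1..r}. \<forall>j<m k.
           ((\<lambda>s. vec_index (transpose_mat (B k) *\<^sub>v block m e k (X s \<omega>)) j) has_integral
             (vec_index (block m e (k + 1) (X t \<omega>)) j - vec_index (block m e (k + 1) x) j))
           {0..t})"
    using X unfolding solves_SDE_def by blast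
  moreover have "AE \<omega> in M. \<forall>t\<ge>0.
        block m e 1 (Y t \<omega>) = block m e 1 y + \<sigma> *\<^sub>v Matrix.vec (m 0) (\<lambda>j. W j t \<omega>) \<and>
        (\<forall>k\<in>{1..r}. \<forall>j<m k.
           ((\<lambda>s. vec_index (transpose_mat (B k) *\<^sub>v block m e k (Y s \<omega>)) j) has_integral
             (vec_index (block m e (k + 1) (Y t \<omega>)) j - vec_index (block m e (k + 1) y) j))
           {0..t})"
    using Y unfolding solves_SDE_def by blast
  ultimately show ?thesis
  proof eventually_elim
    case (elim \<omega>)
    define D where "D s = Y s \<omega> - X s \<omega>" for s
    have "((\<lambda>s. drift (D s)) has_integral D t - (y - x)) {0..t}" if t: "t \<ge> 0" for t
    proof (subst has_integral_componentwise_iff, intro ballI)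
      fix b :: 'a assume "b \<in> Basis"
      then obtain k j where kj: "(k, j) \<in> positions" "b = e k j" by (auto simp: Basis_eq)
      show "((\<lambda>s. inner (drift (D s)) b) has_integral inner (D t - (y - x)) b) {0..t}"
        using kj(1)
      proof (cases rule: position_cases)
        case noisy
        define v where "v = \<sigma> *\<^sub>v Matrix.vec (m 0) (\<lambda>j. W j t \<omega>)"
        have "block m e 1 (X t \<omega>) = block m e 1 x + v" "block m e 1 (Y t \<omega>) = block m e 1 y + v"
          using elim t by (auto simp: v_def)
        moreover from this(1) have "dim_vec v = m 0"
          by (metis block_def diff_self_eq_0 dim_vec index_add_vec(2))
        ultimately have "inner (X t \<omega>) b = inner x b + vec_index v j"
            "inner (Y t \<omega>) b = inner y b + vec_index v j"
          using noisy kj(2) by (auto simp: block_def vec_eq_iff)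
        then have "inner (D t - (y - x)) b = 0"
          by (simp add: D_def inner_diff_left)
        then show ?thesis using kj noisy by (simp add: inner_drift_noisy[simplified])
      next
        case (driven l)
        have X: "((\<lambda>s. \<Sum>i<m (l - 1). B l $$ (i, j) * inner (X s \<omega>) (e l i))
            has_integral inner (X t \<omega>) b - inner x b) {0..t}"
        proof -
          have "((\<lambda>s. vec_index (transpose_mat (B l) *\<^sub>v block m e l (X s \<omega>)) j) has_integral
             (vec_index (block m e (l + 1) (X t \<omega>)) j - vec_index (block m e (l + 1) x) j)) {0..t}"
            using elim(1) t driven(2,3) by blast
          then show ?thesis
            unfolding transpose_mult_block_index[OF driven(2,3)]
            using driven by (simp add: block_def kj(2))
        qed
        have Y: "((\<lambda>s. \<Sum>i<m (l - 1). B l $$ (i, j) * inner (Y s \<omega>) (e l i))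
            has_integral inner (Y t \<omega>) b - inner y b) {0..t}"
        proof -
          have "((\<lambda>s. vec_index (transpose_mat (B l) *\<^sub>v block m e l (Y s \<omega>)) j) has_integral
             (vec_index (block m e (l + 1) (Y t \<omega>)) j - vec_index (block m e (l + 1) y) j)) {0..t}"
            using elim(2) t driven(2,3) by blast
          then show ?thesis
            unfolding transpose_mult_block_index[OF driven(2,3)]
            using driven by (simp add: block_def kj(2))
        qed
        show ?thesis
          using has_integral_diff[OF Y X] kj driven
          by (simp add: D_def inner_drift_driven inner_diff_left algebra_simps sum_subtractf)
      qed
    qed
    then have "D t = flow t (y - x)" if "t \<ge> 0" for t
      using integral_equation_nilpotent[OF linear_drift drift_nilpotent] that by blast
    then show ?case by (auto simp: D_def algebra_simps)
  qed
qed

section \<open>Lifting vectors of the noisy block\<close>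

lemma ordered_prod_carrier:
  "k \<le> r \<Longrightarrow> ordered_prod (m 0) B k \<in> carrier_mat (m 0) (m k)"
proof (induction k)
  case (Suc k)
  then show ?case using B_carrier[of "Suc k"] by simp
qed simp

text \<open>The vector $C_k^* u$ placed in block $k$, where $C_k = B_1 \cdots B_{k-1}$. For $k > r + 1$
  there is no such block and the value is $0$; this makes the shift rule \<open>drift_lift\<close> hold for the
  last block, too.\<close>

definition lift :: "real Matrix.vec \<Rightarrow> nat \<Rightarrow> 'a" where
  "lift u k = of_coords (\<lambda>k' j. if k' = k
     then vec_index (transpose_mat (ordered_prod (m 0) B (k - 1)) *\<^sub>v u) j else 0)"

lemma lift_out_of_range: "k > r + 1 \<Longrightarrow> lift u k = 0"
  by (rule eqI_coords) (auto simp: lift_def inner_of_coords positions_def)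

lemma block_lift:
  assumes "k \<in> {1..r+1}" "u \<in> carrier_vec (m 0)"
  shows "block m e k (lift u k) = transpose_mat (ordered_prod (m 0) B (k - 1)) *\<^sub>v u"
proof -
  have "ordered_prod (m 0) B (k - 1) \<in> carrier_mat (m 0) (m (k - 1))"
    by (rule ordered_prod_carrier) (use assms in auto)
  then show ?thesis using assms
    by (intro eq_vecI) (auto simp: block_def lift_def inner_of_coords positions_def)
qed

text \<open>This is $B_k^* C_k^* = (C_k B_k)^* = C_{k+1}^*$.\<close>

lemma drift_lift:
  assumes k: "k \<ge> 1" and u: "u \<in> carrier_vec (m 0)"
  shows "drift (lift u k) = lift u (Suc k)"
proof (rule eqI_coords)
  fix k' j assume pos: "(k', j) \<in> positions"
  show "inner (drift (lift u k)) (e k' j) = inner (lift u (Suc k)) (e k' j)"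
  proof (cases "k' = Suc k")
    case True
    have kr: "k \<in> {1..r}" "k \<in> {1..r+1}" "j < m k" using pos True k by (auto simp: positions_def)
    have C: "ordered_prod (m 0) B (k - 1) \<in> carrier_mat (m 0) (m (k - 1))"
      by (rule ordered_prod_carrier) (use kr in auto)
    have "ordered_prod (m 0) B k = ordered_prod (m 0) B (k - 1) * B k"
      using k by (cases k) auto
    then have "transpose_mat (ordered_prod (m 0) B k) *\<^sub>v u
        = transpose_mat (B k) *\<^sub>v (transpose_mat (ordered_prod (m 0) B (k - 1)) *\<^sub>v u)"
      using C B_carrier[OF kr(1)] u
      by (simp add: transpose_mult[OF C B_carrier[OF kr(1)], simplified]
          assoc_mult_mat_vec[of _ "m k" "m (k - 1)" _ "m 0"])
    then show ?thesis
      using pos True k u kr by (simp add: drift_def lift_def[of u "Suc k"] inner_of_coords block_lift)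
  next
    case False
    have r: "inner (lift u (Suc k)) (e k' j) = 0"
      using pos False by (simp add: lift_def inner_of_coords)
    from pos show ?thesis
    proof (cases rule: position_cases)
      case noisy
      then show ?thesis using r by (simp add: inner_drift_noisy[simplified])
    next
      case (driven l)
      have "inner (lift u k) (e l i) = 0" if "i < m (l - 1)" for i
        unfolding lift_def
        by (subst inner_of_coords) (use that driven False in \<open>auto simp: positions_def\<close>)
      then show ?thesis using driven r by (simp add: inner_drift_driven)
    qed
  qed
qed

lemma drift_pow_lift:
  assumes "k \<ge> 1" "u \<in> carrier_vec (m 0)"
  shows "(drift ^^ i) (lift u k) = lift u (k + i)"
  by (induction i) (use assms in \<open>simp_all add: drift_lift\<close>)

text \<open>The source of the polynomial coefficients in the gradient estimate. The term $t^i N^i / i!$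
  carries the weight $\alpha_{k-i}$ of block $k - i$ to block $k$, so the weights are convolved with
  the Taylor coefficients of the exponential; contributions past the last block vanish.\<close>

lemma flow_lift_combination:
  assumes u: "u \<in> carrier_vec (m 0)"
  shows "flow t (\<Sum>k\<in>{1..r+1}. \<alpha> k *\<^sub>R lift u k)
       = (\<Sum>k\<in>{1..r+1}. (\<Sum>i=0..k - 1. \<alpha> (k - i) * (t ^ i / fact i)) *\<^sub>R lift u k)"
proof -
  let ?g = "\<lambda>k i. (\<alpha> k * (t ^ i / fact i)) *\<^sub>R lift u (k + i)"
  have "(drift ^^ i) (\<Sum>k\<in>{1..r+1}. \<alpha> k *\<^sub>R lift u k)
          = (\<Sum>k\<in>{1..r+1}. \<alpha> k *\<^sub>R lift u (k + i))" for i
    using linear_funpow[OF linear_drift, of i] u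
    by (simp add: linear_sum linear_cmul drift_pow_lift del: sum.cl_ivl_Suc)
  then have "flow t (\<Sum>k\<in>{1..r+1}. \<alpha> k *\<^sub>R lift u k)
      = (\<Sum>i\<le>r. \<Sum>k\<in>{1..r+1}. ?g k i)"
    by (simp add: nilpotent_flow_def scaleR_sum_right mult.commute del: sum.cl_ivl_Suc)
  also have "\<dots> = (\<Sum>(i, k)\<in>{..r} \<times> {1..r+1}. ?g k i)"
    by (rule sum.cartesian_product)
  also have "\<dots> = (\<Sum>(i, k)\<in>{(i, k). 1 \<le> k \<and> k + i \<le> r + 1}. ?g k i)"
  proof (rule sum.mono_neutral_right)
    show "\<forall>p\<in>{..r} \<times> {1..r+1} - {(i, k). 1 \<le> k \<and> k + i \<le> r + 1}.
        (case p of (i, k) \<Rightarrow> ?g k i) = 0"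
    proof
      fix p assume "p \<in> {..r} \<times> {1..r+1} - {(i, k). 1 \<le> k \<and> k + i \<le> r + 1}"
      then obtain i k where "p = (i, k)" "k + i > r + 1" by (cases p) auto
      then show "(case p of (i, k) \<Rightarrow> ?g k i) = 0" by (simp add: lift_out_of_range)
    qed
  qed auto
  also have "\<dots> = (\<Sum>(k, i)\<in>(SIGMA k:{1..r+1}. {0..k - 1}). ?g (k - i) i)"
    by (rule sum.reindex_bij_witness[where j = "\<lambda>(i, k). (k + i, i)" and i = "\<lambda>(k, i). (i, k - i)"])
       auto
  also have "\<dots> = (\<Sum>k\<in>{1..r+1}. \<Sum>i=0..k - 1. ?g (k - i) i)"
    by (rule sum.Sigma[symmetric]) auto
  also have "\<dots> = (\<Sum>k\<in>{1..r+1}. (\<Sum>i=0..k - 1. \<alpha> (k - i) * (t ^ i / fact i)) *\<^sub>R lift u k)"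
    unfolding scaleR_sum_left by (intro sum.cong refl) auto
  finally show ?thesis .
qed

text \<open>Transposing $C_k$ onto $u$ turns the scalar product into a linear combination of partial
  derivatives, hence into a derivative along a combination of the vectors \<open>lift u k\<close>. The
  functional $q$ stands for the differential of $g$ at $x$; it is tied to $g$ through the partial
  derivatives because for $g = \ln P_t f$ only directional derivatives have been computed.\<close>

lemma scalar_prod_weighted_gradient:
  assumes u: "u \<in> carrier_vec (m 0)" and q: "linear q"
    and deriv: "\<And>k j. (k, j) \<in> positions \<Longrightarrow> deriv (\<lambda>s. g (x + s *\<^sub>R e k j)) 0 = q (e k j)"
    and T: "\<And>k. k \<in> {1..r+1} \<Longrightarrow>
      T k = c k \<cdot>\<^sub>v (ordered_prod (m 0) B (k - 1) *\<^sub>v block_grad m e k g x)"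
  shows "scalar_prod u (finsum_vec TYPE(real) (m 0) T {1..r+1})
       = q (\<Sum>k\<in>{1..r+1}. c k *\<^sub>R lift u k)"
    and "finsum_vec TYPE(real) (m 0) T {1..r+1} \<in> carrier_vec (m 0)"
proof -
  have C: "ordered_prod (m 0) B (k - 1) \<in> carrier_mat (m 0) (m (k - 1))" if "k \<in> {1..r+1}" for k
    by (rule ordered_prod_carrier) (use that in auto)
  have G: "block_grad m e k g x \<in> carrier_vec (m (k - 1))" for k
    by (simp add: block_grad_def)
  have Tc: "T \<in> {1..r+1} \<rightarrow> carrier_vec (m 0)"
    using mult_mat_vec_carrier[OF C G] T by auto
  then show "finsum_vec TYPE(real) (m 0) T {1..r+1} \<in> carrier_vec (m 0)"
    by (rule finsum_vec_closed)
  have "scalar_prod u (T k) = q (c k *\<^sub>R lift u k)" if k: "k \<in> {1..r+1}" for k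
  proof -
    let ?w = "transpose_mat (ordered_prod (m 0) B (k - 1)) *\<^sub>v u"
    have "lift u k = (\<Sum>(k', j)\<in>positions. if k' = k then vec_index ?w j *\<^sub>R e k j else 0)"
      unfolding lift_def of_coords_def by (intro sum.cong refl) auto
    also have "\<dots> = (\<Sum>k'\<in>{1..r+1}. \<Sum>j<m (k' - 1).
                        if k' = k then vec_index ?w j *\<^sub>R e k j else 0)"
      unfolding positions_def by (rule sum.Sigma[symmetric]) auto
    also have "\<dots> = (\<Sum>k'\<in>{1..r+1}. if k' = k
                        then \<Sum>j<m (k - 1). vec_index ?w j *\<^sub>R e k j else 0)"
      by (intro sum.cong refl) auto
    also have "\<dots> = (\<Sum>j<m (k - 1). vec_index ?w j *\<^sub>R e k j)" using k by simp
    finally have lift: "lift u k = (\<Sum>j<m (k - 1). vec_index ?w j *\<^sub>R e k j)" .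
    have "scalar_prod u (T k) = c k * scalar_prod ?w (block_grad m e k g x)"
      using transpose_vec_mult_scalar[OF C[OF k] G u] C[OF k] u by (simp add: T[OF k])
    also have "scalar_prod ?w (block_grad m e k g x)
        = (\<Sum>j<m (k - 1). vec_index ?w j * q (e k j))"
      unfolding scalar_prod_def lessThan_atLeast0
      by (rule sum.cong)
         (use k deriv in \<open>auto simp: block_grad_def positions_def\<close>)
    also have "c k * \<dots> = q (c k *\<^sub>R lift u k)"
      by (simp add: lift linear_cmul[OF q] linear_sum[OF q])
    finally show ?thesis .
  qed
  then show "scalar_prod u (finsum_vec TYPE(real) (m 0) T {1..r+1})
       = q (\<Sum>k\<in>{1..r+1}. c k *\<^sub>R lift u k)"
    unfolding scalar_prod_finsum_vec[OF finite_atLeastAtMost Tc] linear_sum[OF q] o_def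
    by (intro sum.cong refl)
qed

end

section \<open>The gradient estimate\<close>

theorem proposition2p9:
  fixes r :: nat and m :: "nat \<Rightarrow> nat"
    and e :: "nat \<Rightarrow> nat \<Rightarrow> 'a::euclidean_space"
    and \<sigma> A0 :: "real mat" and B :: "nat \<Rightarrow> real mat"
    and M :: "'w measure" and W :: "nat \<Rightarrow> real \<Rightarrow> 'w \<Rightarrow> real"
    and X :: "'a \<Rightarrow> real \<Rightarrow> 'w \<Rightarrow> 'a"
    and f :: "'a \<Rightarrow> real" and L :: real
    and t :: real and x :: 'a and \<alpha> :: "nat \<Rightarrow> real"
  assumes "r \<ge> 1"
    and "\<forall>k\<in>{1..r}. m k \<le> m (k - 1)" and "m r \<ge> 1"
    and "block_basis r m e"
    and "\<sigma> \<in> carrier_mat (m 0) (m 0)" and "A0 = \<sigma> * transpose_mat \<sigma>"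
    and "\<forall>k\<in>{1..r}. B k \<in> carrier_mat (m (k - 1)) (m k) \<and> vec_space.rank (m (k - 1)) (B k) = m k"
    and "standard_BM M (m 0) W"
    and "\<forall>y. solves_SDE M r m e \<sigma> B W y (X y)"
    and "C2 f" and "\<forall>y. f y > 0" and "L-lipschitz_on UNIV f" and "bounded (range f)"
    and "t \<ge> 0" and "\<alpha> 1 = 1"
  shows
    "ennreal (diffusion_semigroup M X t f x *
       (seminorm_of A0
         (finsum_vec TYPE(real) (m 0)
           (\<lambda>i'. \<alpha> i' \<cdot>\<^sub>v (ordered_prod (m 0) B (i' - 1) *\<^sub>v
                  block_grad m e i' (\<lambda>y. ln (diffusion_semigroup M X t f y)) x))
           {1..r+1}))\<^sup>2)
     \<le> nn_diffusion_semigroup M X t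
         (\<lambda>y. f y *
           (seminorm_of A0
             (finsum_vec TYPE(real) (m 0)
               (\<lambda>i'. ((\<Sum>i=0..i' - 1. \<alpha> (i' - i) * (t ^ i / fact i)) \<cdot>\<^sub>m
                        ordered_prod (m 0) B (i' - 1)) *\<^sub>v
                      block_grad m e i' (\<lambda>z. ln (f z)) y)
               {1..r+1}))\<^sup>2) x"
proof -
  interpret block_chain r m e B
    by standard (use assms in auto)
  interpret prob_space M using assms(8) by (simp add: standard_BM_def)
  obtain f' :: "'a \<Rightarrow> 'a \<Rightarrow>\<^sub>L real" where f': "\<And>y. (f has_derivative f' y) (at y)"
    using \<open>C2 f\<close> unfolding C2_def by blast
  have fpos: "f y > 0" for y using assms(11) by blast
  define Z where "Z = X x t"
  let ?P = "expectation (\<lambda>\<omega>. f (Z \<omega>))"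
  have Xm: "X y t \<in> borel_measurable M" for y
    using assms(9) \<open>t \<ge> 0\<close> by (auto simp: solves_SDE_def)
  have contf: "continuous_on UNIV f"
    using has_derivative_continuous[OF f'] by (auto intro!: continuous_at_imp_continuous_on)
  have fm [measurable]: "f \<in> borel_measurable borel"
    by (rule borel_measurable_continuous_onI[OF contf])
  have Zm [measurable]: "Z \<in> borel_measurable M" unfolding Z_def by (rule Xm)
  have fint: "integrable M (\<lambda>\<omega>. f (Z \<omega>))"
  proof -
    obtain K where "\<And>y. \<bar>f y\<bar> \<le> K" using assms(13) by (auto simp: bounded_iff)
    then show ?thesis by (intro integrable_const_bound[where B = K]) auto
  qed
  have P: "?P > 0" by (rule expectation_pos[OF fint fpos])
  note deriv_f = expectation_directional_derivative[OF Zm f' assms(12,13)]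
  have shift: "diffusion_semigroup M X t f (x + h) = expectation (\<lambda>\<omega>. f (Z \<omega> + flow t h))" for h
    unfolding diffusion_semigroup_def
  proof (rule integral_cong_AE)
    show "AE \<omega> in M. f (X (x + h) t \<omega>) = f (Z \<omega> + flow t h)"
      using solutions_differ_by_flow[of M \<sigma> W x "X x" "x + h" "X (x + h)"] assms(9) \<open>t \<ge> 0\<close>
      by (auto simp: Z_def elim!: eventually_mono)
  qed (use Xm in measurable)
  have flow: "linear (flow t)" by (rule linear_nilpotent_flow[OF linear_drift])
  \<comment> \<open>\<open>q h\<close> is the derivative of \<open>ln (P_t f)\<close> at \<open>x\<close> in direction \<open>h\<close>, see \<open>grad_P\<close>\<close>
  define q where "q h = expectation (\<lambda>\<omega>. f' (Z \<omega>) (flow t h)) / ?P" for h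
  have q: "linear q"
    by (rule linearI)
       (simp_all add: q_def linear_add[OF flow] linear_cmul[OF flow] blinfun.add_right
          blinfun.scaleR_right deriv_f(1) add_divide_distrib)
  have grad_P: "deriv (\<lambda>s. ln (diffusion_semigroup M X t f (x + s *\<^sub>R h))) 0 = q h" for h
  proof -
    have "((\<lambda>s. expectation (\<lambda>\<omega>. f (Z \<omega> + s *\<^sub>R flow t h))) has_real_derivative
            expectation (\<lambda>\<omega>. f' (Z \<omega>) (flow t h))) (at 0)"
      by (rule deriv_f(2))
    then have "((\<lambda>s. ln (expectation (\<lambda>\<omega>. f (Z \<omega> + s *\<^sub>R flow t h)))) has_real_derivative
            1 / ?P * expectation (\<lambda>\<omega>. f' (Z \<omega>) (flow t h))) (at 0)"
      using P DERIV_chain2[of ln "1 / ?P" "\<lambda>s. expectation (\<lambda>\<omega>. f (Z \<omega> + s *\<^sub>R flow t h))" 0]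
      by (simp add: DERIV_ln_divide)
    then show ?thesis
      by (intro DERIV_imp_deriv) (simp add: shift linear_cmul[OF flow] q_def)
  qed
  have grad_f: "deriv (\<lambda>s. ln (f (y + s *\<^sub>R h))) 0 = f' y h / f y" for y h
  proof -
    have "((\<lambda>s. f (y + s *\<^sub>R h)) has_real_derivative f' y h) (at 0)"
      by (rule DERIV_along_line[OF f'])
    then have "((\<lambda>s. ln (f (y + s *\<^sub>R h))) has_real_derivative 1 / f y * f' y h) (at 0)"
      using fpos[of y] DERIV_chain2[of ln "1 / f y" "\<lambda>s. f (y + s *\<^sub>R h)" 0]
      by (simp add: DERIV_ln_divide)
    then show ?thesis by (intro DERIV_imp_deriv) simp
  qed
  let ?G = "finsum_vec TYPE(real) (m 0)
         (\<lambda>i'. \<alpha> i' \<cdot>\<^sub>v (ordered_prod (m 0) B (i' - 1) *\<^sub>v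
                  block_grad m e i' (\<lambda>y. ln (diffusion_semigroup M X t f y)) x)) {1..r+1}"
  let ?\<beta> = "\<lambda>k. \<Sum>i=0..k - 1. \<alpha> (k - i) * (t ^ i / fact i)"
  let ?H = "\<lambda>y. finsum_vec TYPE(real) (m 0)
         (\<lambda>i'. (?\<beta> i' \<cdot>\<^sub>m ordered_prod (m 0) B (i' - 1)) *\<^sub>v
                  block_grad m e i' (\<lambda>z. ln (f z)) y) {1..r+1}"
  \<comment> \<open>the direction in which \<open>ln (P_t f)\<close> is differentiated when its combined gradient is paired
      with the column \<open>l\<close> of \<open>\<sigma>\<close>\<close>
  define v where "v l = (\<Sum>k\<in>{1..r+1}. \<alpha> k *\<^sub>R lift (col \<sigma> l) k)" for l
  have u: "col \<sigma> l \<in> carrier_vec (m 0)" for l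
    using assms(5) by (intro carrier_vecI) simp
  have flow_v: "flow t (v l) = (\<Sum>k\<in>{1..r+1}. ?\<beta> k *\<^sub>R lift (col \<sigma> l) k)" for l
    unfolding v_def by (rule flow_lift_combination[OF u])
  have H_form: "(?\<beta> k \<cdot>\<^sub>m ordered_prod (m 0) B (k - 1)) *\<^sub>v block_grad m e k (\<lambda>z. ln (f z)) y
      = ?\<beta> k \<cdot>\<^sub>v (ordered_prod (m 0) B (k - 1) *\<^sub>v block_grad m e k (\<lambda>z. ln (f z)) y)"
    if "k \<in> {1..r+1}" for k y
    by (rule smult_mat_mult_vec[OF ordered_prod_carrier]) (use that in \<open>auto simp: block_grad_def\<close>)
  have lin_f: "linear (\<lambda>h. f' y h / f y)" for y
    by (rule linearI) (simp_all add: blinfun.add_right blinfun.scaleR_right add_divide_distrib)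
  have P_t: "diffusion_semigroup M X t f x = ?P"
    by (simp add: diffusion_semigroup_def Z_def)
  have G_col: "scalar_prod (col \<sigma> l) ?G
      = expectation (\<lambda>\<omega>. f' (Z \<omega>) (flow t (v l))) / ?P" for l
    unfolding v_def q_def[symmetric]
    by (rule scalar_prod_weighted_gradient(1)[OF u q grad_P refl])
  have "(seminorm_of A0 ?G)\<^sup>2 = (\<Sum>l<m 0. (scalar_prod (col \<sigma> l) ?G)\<^sup>2)"
    unfolding assms(6)
    by (rule seminorm_of_gram_sq[OF assms(5)],
        rule scalar_prod_weighted_gradient(2)[OF u q grad_P refl])
  then have lhs: "diffusion_semigroup M X t f x * (seminorm_of A0 ?G)\<^sup>2
      = ?P * (\<Sum>l<m 0. (expectation (\<lambda>\<omega>. f' (Z \<omega>) (flow t (v l))) / ?P)\<^sup>2)"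
    by (simp only: G_col P_t)
  have H_col: "scalar_prod (col \<sigma> l) (?H y) = f' y (flow t (v l)) / f y" for l y
    unfolding flow_v by (rule scalar_prod_weighted_gradient(1)[OF u lin_f grad_f H_form])
  have "(seminorm_of A0 (?H y))\<^sup>2 = (\<Sum>l<m 0. (scalar_prod (col \<sigma> l) (?H y))\<^sup>2)" for y
    unfolding assms(6)
    by (rule seminorm_of_gram_sq[OF assms(5)],
        rule scalar_prod_weighted_gradient(2)[OF u lin_f grad_f H_form])
  then have rhs: "(seminorm_of A0 (?H y))\<^sup>2
      = (\<Sum>l<m 0. (f' y (flow t (v l)) / f y)\<^sup>2)" for y
    by (simp only: H_col)
  show ?thesis
    unfolding lhs rhs nn_diffusion_semigroup_def
    unfolding Z_def[symmetric]
    by (rule weighted_Cauchy_Schwarz[OF fint fpos deriv_f(1) finite_lessThan])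
qed

end
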